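(* Let $m,n\in\mathbb{N}$. For every integer $r$ with $0\le r\le\min\{m,n\}$ there exists an open and dense subset $\mathcal{A}_r$ of $M_r=\{A\in\mathbb{R}^{m\times n} : \operatorname{rank}A=r\}$ such that for all $A\in\mathcal{A}_r$ and all $d\in\mathbb{N}$ the rank of the $d$-th Hadamard power equals $$\operatorname{rank}A^{\circ d}=\min\left\{\binom{r+d-1}{d},n,m\right\}.$$
   Context: $\mathbb{N}=\{1,2,3,\ldots\}$. For a real matrix $A=(a_{ij})$ and $d\in\mathbb{N}$, the $d$-th Hadamard power is the entrywise power $A^{\circ d}=(a_{ij}^d)$. The set $M_r$ carries the topology inherited from $\mathbb{R}^{m\times n}$; "open and dense" is meant relative to $M_r$. Convention: $\binom{d-1}{d}=0$ for $d\ge 1$ (relevant for $r=0$). *)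

theory Defs
  imports "HOL-Analysis.Analysis"
begin

definition hadamard_power :: "real^'n^'m \<Rightarrow> nat \<Rightarrow> real^'n^'m" where
  "hadamard_power A d = (\<chi> i j. (A $ i $ j) ^ d)"

definition rank_stratum :: "nat \<Rightarrow> (real^'n^'m) set" where
  "rank_stratum r = {A. rank A = r}"

end

theory Submission
  imports Defs "Jordan_Normal_Form.Determinant"
begin

text \<open>
  Write a matrix of rank \<open>r\<close> as \<open>A = \<Sum>l<r. u\<^sub>l v\<^sub>l\<^sup>T\<close>. The multinomial theorem turns \<open>A\<close> to the
  Hadamard power \<open>d\<close> into a sum of matrices of rank at most one, one for each weak composition of \<open>d\<close> into
  \<open>r\<close> parts (\<open>multinomial_theorem\<close>). There are \<open>(r + d - 1) choose d\<close> of them, which bounds the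
  rank from above for every \<open>A\<close> (\<open>rank_hadamard_power_le\<close>).

  For the lower bound let \<open>k = min m n\<close>. It suffices that for every \<open>d \<ge> 1\<close> the leading minor
  of order \<open>min ((r + d - 1) choose d) k\<close> of the power is nonzero. These are countably many
  polynomial conditions on \<open>A\<close>, so the difficulties are to satisfy all of them near every given
  matrix, and to have infinitely many of them cut out an open set.

  Density. Matrices of rank at most \<open>r\<close> are joined by polynomial paths, obtained from line segments
  between their factors, and a polynomial in one variable that does not vanish identically has
  finitely many zeros. Hence countably many conditions can be met arbitrarily close to a given
  matrix as soon as each of them holds at some point of the path (\<open>generic_outer_product_sum\<close>).
  A single matrix meets all minor conditions: the one with entries \<open>\<Sum>l<r. p\<^sub>l ^ (i + j)\<close> for
  distinct primes \<open>p\<^sub>l\<close>. The monomials of degree \<open>d\<close> in the \<open>p\<^sub>l\<close> are distinct by unique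
  factorisation, and a leading block of the power is the Gram matrix of a Vandermonde system with
  these monomials as nodes, so it is positive definite as long as its order does not exceed their
  number (\<open>power_sum_hadamard_minor_nonzero\<close>).

  Openness. For \<open>d \<ge> k\<close> the order of the minor is a constant \<open>s\<close>, and by the Leibniz formula the
  minor is a signed sum of \<open>d\<close>-th powers of the products of the entries of \<open>A\<close> along the
  transversals of the \<open>s \<times> s\<close> block. If these products have distinct absolute values, the largest
  one dominates all others in a neighbourhood of \<open>A\<close>, by a factor bounded away from 1. Therefore
  one neighbourhood serves all large \<open>d\<close>
  (\<open>dominant_transversal_neighbourhood\<close>), and the remaining \<open>d\<close> are finitely many. Distinctness of
  the products is a further polynomial condition. The power-sum matrix violates it, being symmetric:
  a permutation and its inverse give the same product, and from order 3 on some permutations are not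
  their own inverse. So it has its own witness, a matrix of rank
  at most 2 with pairwise coprime entries (\<open>ex_distinct_transversal_products\<close>), and
  \<open>hadamard_generic_dense\<close> perturbs twice.
\<close>

no_notation vec_index (infixl "$" 100)

section \<open>The multinomial theorem over weak compositions\<close>

definition weak_compositions :: "nat \<Rightarrow> nat \<Rightarrow> nat list set" where
  "weak_compositions r d = {e. length e = r \<and> sum_list e = d}"

text \<open>
  The multinomial coefficient \<open>d! / (e\<^sub>1! \<cdots> e\<^sub>r!)\<close>, as the product of binomial coefficients that
  peeling off one summand after the other produces.
\<close>

primrec multinomial :: "nat list \<Rightarrow> nat" where
  "multinomial [] = 1"
| "multinomial (k # e) = ((k + sum_list e) choose k) * multinomial e"

lemma card_weak_compositions: "card (weak_compositions r d) = (r + d - 1) choose d"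
  unfolding weak_compositions_def by (simp add: card_length_sum_list add.commute)

lemma weak_compositions_0: "weak_compositions 0 d = (if d = 0 then {[]} else {})"
  by (auto simp: weak_compositions_def)

lemma weak_compositions_Suc:
  "weak_compositions (Suc r) d = (\<Union>k\<le>d. (#) k ` weak_compositions r (d - k))"
proof (rule Set.set_eqI)
  fix e show "e \<in> weak_compositions (Suc r) d \<longleftrightarrow> e \<in> (\<Union>k\<le>d. (#) k ` weak_compositions r (d - k))"
    by (cases e) (auto simp: weak_compositions_def image_iff)
qed

lemma finite_weak_compositions: "finite (weak_compositions r d)"
  by (induction r arbitrary: d) (auto simp: weak_compositions_0 weak_compositions_Suc)

lemma multinomial_pos: "multinomial e > 0"
  by (induction e) auto

lemma multinomial_theorem:
  fixes x :: "nat \<Rightarrow> 'a::comm_semiring_1"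
  shows "(\<Sum>l<r. x l) ^ d =
    (\<Sum>e\<in>weak_compositions r d. of_nat (multinomial e) * (\<Prod>l<r. x l ^ (e ! l)))"
proof (induction r arbitrary: d x)
  case 0
  then show ?case by (cases d) (auto simp: weak_compositions_0)
next
  case (Suc r)
  let ?m = "\<lambda>x r e. of_nat (multinomial e) * (\<Prod>l<r. x l ^ (e ! l)) :: 'a"
  have "(\<Sum>l<Suc r. x l) ^ d = (x 0 + (\<Sum>l<r. x (Suc l))) ^ d"
    by (simp only: sum.lessThan_Suc_shift)
  also have "\<dots> = (\<Sum>k\<le>d. of_nat (d choose k) * x 0 ^ k * (\<Sum>l<r. x (Suc l)) ^ (d - k))"
    by (rule binomial_ring)
  also have "\<dots> = (\<Sum>k\<le>d. \<Sum>e\<in>weak_compositions r (d - k). ?m x (Suc r) (k # e))"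
    unfolding Suc.IH sum_distrib_left
    by (intro sum.cong refl)
       (auto simp: weak_compositions_def prod.lessThan_Suc_shift algebra_simps simp del: prod.lessThan_Suc)
  also have "\<dots> = (\<Sum>k\<le>d. \<Sum>e\<in>(#) k ` weak_compositions r (d - k). ?m x (Suc r) e)"
    by (rule sum.cong [OF refl]) (simp add: sum.reindex del: prod.lessThan_Suc)
  also have "\<dots> = (\<Sum>e\<in>weak_compositions (Suc r) d. ?m x (Suc r) e)"
    unfolding weak_compositions_Suc
    by (rule sum.UNION_disjoint [symmetric]) (auto simp: finite_weak_compositions)
  finally show ?case .
qed

section \<open>The upper bound for the rank of a Hadamard power\<close>

text \<open>
  The columns of \<open>U\<close> are a basis of the column space, the rows of \<open>V\<close> hold the coordinates. The
  factors are indexed by natural numbers, so that the rank is not tied to an index type.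
\<close>

lemma rank_factorization:
  fixes A :: "real^'n^'m"
  obtains U V where "A = (\<chi> i j. \<Sum>l<rank A. U i l * V j l)"
proof -
  obtain B where B: "B \<subseteq> columns A" "independent B" "columns A \<subseteq> span B" "card B = dim (columns A)"
    using basis_exists by blast
  have fin: "finite B" and cB: "card B = rank A"
    using B by (auto simp: independent_imp_finite column_rank_def)
  obtain h where h: "bij_betw h {..<rank A} B"
    using ex_bij_betw_nat_finite[OF fin] unfolding cB by (auto simp: atLeast0LessThan)
  have "\<exists>c. column j A = (\<Sum>l<rank A. c l *\<^sub>R h l)" for j
  proof -
    have "column j A \<in> span B" using B by (auto simp: columns_def)
    then obtain u where "column j A = (\<Sum>b\<in>B. u b *\<^sub>R b)"
      using fin by (auto simp: span_finite)
    also have "\<dots> = (\<Sum>l<rank A. u (h l) *\<^sub>R h l)"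
      using h by (simp add: sum.reindex_bij_betw [symmetric])
    finally show ?thesis by (intro exI[of _ "\<lambda>l. u (h l)"])
  qed
  then obtain V where V: "\<And>j. column j A = (\<Sum>l<rank A. V j l *\<^sub>R h l)"
    by metis
  have "A $ i $ j = (\<Sum>l<rank A. h l $ i * V j l)" for i j
  proof -
    have "A $ i $ j = column j A $ i" by (simp add: column_def)
    also have "\<dots> = (\<Sum>l<rank A. h l $ i * V j l)" by (simp add: V mult.commute)
    finally show ?thesis .
  qed
  then show ?thesis
    by (intro that[of "\<lambda>i l. h l $ i" V]) (simp add: Finite_Cartesian_Product.vec_eq_iff)
qed

text \<open>
  By the multinomial theorem, each column of the power is a combination of the vectors \<open>w e\<close>, the
  monomials in the columns of \<open>U\<close> with exponents \<open>e\<close>.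
\<close>

lemma rank_hadamard_power_le:
  fixes A :: "real^'n^'m"
  assumes A: "A = (\<chi> i j. \<Sum>l<r. U i l * V j l)"
  shows "rank (hadamard_power A d) \<le> (r + d - 1) choose d"
proof -
  let ?E = "weak_compositions r d"
  define w where "w e = (\<chi> i. \<Prod>l<r. U i l ^ (e ! l) :: real^'m)" for e
  have "column j (hadamard_power A d) =
      (\<Sum>e\<in>?E. (real (multinomial e) * (\<Prod>l<r. V j l ^ (e ! l))) *\<^sub>R w e)" for j
  proof (rule Finite_Cartesian_Product.vec_eq_iff[THEN iffD2], rule allI)
    fix i
    have "column j (hadamard_power A d) $ i = (\<Sum>l<r. U i l * V j l) ^ d"
      by (simp add: column_def hadamard_power_def A)
    also have "\<dots> = (\<Sum>e\<in>?E. real (multinomial e) * (\<Prod>l<r. V j l ^ (e ! l)) * (\<Prod>l<r. U i l ^ (e ! l)))"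
      by (simp add: multinomial_theorem power_mult_distrib prod.distrib mult_ac)
    finally show "column j (hadamard_power A d) $ i =
        (\<Sum>e\<in>?E. (real (multinomial e) * (\<Prod>l<r. V j l ^ (e ! l))) *\<^sub>R w e) $ i"
      by (simp add: w_def)
  qed
  also have "\<dots> j \<in> span (w ` ?E)" for j
    by (intro span_sum span_scale span_base imageI)
  finally have "columns (hadamard_power A d) \<subseteq> span (w ` ?E)"
    by (auto simp: columns_def)
  then have "rank (hadamard_power A d) \<le> card (w ` ?E)"
    unfolding column_rank_def by (intro dim_le_card) (auto simp: finite_weak_compositions)
  also have "\<dots> \<le> card ?E" by (intro card_image_le finite_weak_compositions)
  finally show ?thesis by (simp add: card_weak_compositions)
qed

lemma hadamard_power_1: "hadamard_power A 1 = A"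
  by (simp add: hadamard_power_def Finite_Cartesian_Product.vec_eq_iff)

section \<open>Minors of Hadamard powers\<close>

text \<open>
  The order of the minors varies with \<open>d\<close>, so rows and columns are selected by functions on the
  natural numbers.
\<close>

definition hadamard_minor ::
    "(nat \<Rightarrow> 'm) \<Rightarrow> (nat \<Rightarrow> 'n) \<Rightarrow> nat \<Rightarrow> nat \<Rightarrow> real^'n^'m \<Rightarrow> real" where
  "hadamard_minor \<rho> \<kappa> s d A = Determinant.det (Matrix.mat s s (\<lambda>(i, j). (A $ \<rho> i $ \<kappa> j) ^ d))"

definition transversal_product ::
    "(nat \<Rightarrow> 'm) \<Rightarrow> (nat \<Rightarrow> 'n) \<Rightarrow> nat \<Rightarrow> (nat \<Rightarrow> nat) \<Rightarrow> real^'n^'m \<Rightarrow> real" where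
  "transversal_product \<rho> \<kappa> s \<sigma> A = (\<Prod>i<s. A $ \<rho> i $ \<kappa> (\<sigma> i))"

lemma hadamard_minor_expansion:
  "hadamard_minor \<rho> \<kappa> s d A =
    (\<Sum>\<sigma> | \<sigma> permutes {..<s}. of_int (sign \<sigma>) * transversal_product \<rho> \<kappa> s \<sigma> A ^ d)"
  unfolding hadamard_minor_def transversal_product_def
  by (subst det_def'[of _ s])
     (auto simp: lessThan_atLeast0 prod_power_distrib permutes_in_image intro!: sum.cong prod.cong)

lemma det_mat_nonzeroI:
  fixes f :: "nat \<Rightarrow> nat \<Rightarrow> real"
  assumes "\<And>c. (\<And>i. i < s \<Longrightarrow> (\<Sum>j<s. f i j * c j) = 0) \<Longrightarrow> \<forall>j<s. c j = 0"
  shows "Determinant.det (Matrix.mat s s (\<lambda>(i, j). f i j)) \<noteq> 0"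
proof
  assume "Determinant.det (Matrix.mat s s (\<lambda>(i, j). f i j)) = 0"
  then obtain v where v: "v \<in> carrier_vec s" "v \<noteq> 0\<^sub>v s"
      "Matrix.mat s s (\<lambda>(i, j). f i j) *\<^sub>v v = 0\<^sub>v s"
    by (subst (asm) det_0_iff_vec_prod_zero[of _ s]) auto
  have "(\<Sum>j<s. f i j * vec_index v j) = 0" if "i < s" for i
    using arg_cong[OF v(3), of "\<lambda>w. vec_index w i"] v(1) that
    by (simp add: scalar_prod_def lessThan_atLeast0)
  then have "\<forall>j<s. vec_index v j = 0" by (rule assms)
  with v(1) have "v = 0\<^sub>v s" by (intro eq_vecI) auto
  with v(2) show False ..
qed

lemma det_mat_nonzeroD:
  fixes f :: "nat \<Rightarrow> nat \<Rightarrow> real"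
  assumes "Determinant.det (Matrix.mat s s (\<lambda>(i, j). f i j)) \<noteq> 0"
    and "\<And>i. i < s \<Longrightarrow> (\<Sum>j<s. f i j * c j) = 0" and "j < s"
  shows "c j = 0"
proof -
  let ?v = "Matrix.vec s c"
  have "Matrix.mat s s (\<lambda>(i, j). f i j) *\<^sub>v ?v = 0\<^sub>v s"
    using assms(2) by (intro eq_vecI) (auto simp: scalar_prod_def lessThan_atLeast0)
  with assms(1) have "?v = 0\<^sub>v s"
    using det_0_iff_vec_prod_zero[OF mat_carrier, of s "\<lambda>(i, j). f i j"] vec_carrier[of s c]
    by blast
  then have "vec_index ?v j = vec_index (0\<^sub>v s) j" by (rule arg_cong)
  then show ?thesis using assms(3) by simp
qed

text \<open>
  A vanishing combination of the selected columns, restricted to the selected rows, is a kernel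
  vector of the nonsingular block; so the selected columns are independent.
\<close>

lemma hadamard_minor_le_rank:
  fixes A :: "real^'n^'m"
  assumes nz: "hadamard_minor \<rho> \<kappa> s d A \<noteq> 0"
  shows "s \<le> rank (hadamard_power A d)"
proof -
  let ?B = "hadamard_power A d"
  let ?col = "\<lambda>j. column (\<kappa> j) ?B"
  have zero: "\<forall>j<s. c j = 0" if "(\<Sum>j<s. c j *\<^sub>R ?col j) = 0" for c
  proof (intro allI impI)
    fix j assume "j < s"
    show "c j = 0"
    proof (rule det_mat_nonzeroD[OF nz[unfolded hadamard_minor_def] _ \<open>j < s\<close>])
      fix i assume "i < s"
      have "(\<Sum>j<s. c j *\<^sub>R ?col j) $ \<rho> i = 0" using that by simp
      then show "(\<Sum>j<s. (A $ \<rho> i $ \<kappa> j) ^ d * c j) = 0"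
        by (simp add: column_def hadamard_power_def mult.commute)
    qed
  qed
  have inj: "inj_on ?col {..<s}"
  proof (rule inj_onI, rule ccontr)
    fix a b assume ab: "a \<in> {..<s}" "b \<in> {..<s}" "?col a = ?col b" "a \<noteq> b"
    \<comment> \<open>Two equal columns would give the nontrivial relation with coefficients 1 and -1.\<close>
    define c where "c j = (if j = a then 1 else if j = b then - 1 else 0 :: real)" for j
    have "(\<Sum>j<s. c j *\<^sub>R ?col j) = (\<Sum>j\<in>{a, b}. c j *\<^sub>R ?col j)"
      using ab by (intro sum.mono_neutral_right) (auto simp: c_def)
    also have "\<dots> = 0" using ab by (simp add: c_def)
    finally have "c a = 0" using zero ab by blast
    then show False by (simp add: c_def)
  qed
  have "independent (?col ` {..<s})"
  proof (subst independent_explicit, intro conjI allI impI ballI)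
    fix u v assume u: "(\<Sum>v\<in>?col ` {..<s}. u v *\<^sub>R v) = 0" and v: "v \<in> ?col ` {..<s}"
    have "(\<Sum>j<s. u (?col j) *\<^sub>R ?col j) = 0" using u by (simp add: sum.reindex[OF inj])
    from zero[OF this] v show "u v = 0" by auto
  qed auto
  moreover have "?col ` {..<s} \<subseteq> span (columns ?B)"
    by (auto simp: columns_def intro!: span_base)
  ultimately have "card (?col ` {..<s}) \<le> dim (columns ?B)"
    by (metis dim_span independent_card_le_dim)
  then show ?thesis by (simp add: card_image[OF inj] column_rank_def)
qed

section \<open>A matrix with nonzero minors for all exponents\<close>

lemma inj_on_prime_monomials:
  fixes p :: "nat \<Rightarrow> nat"
  assumes p: "inj p" "\<And>l. prime (p l)"
  shows "inj_on (\<lambda>e. \<Prod>l<r. real (p l) ^ (e ! l)) (weak_compositions r d)"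
proof (rule inj_onI)
  fix e e' assume e: "e \<in> weak_compositions r d" "e' \<in> weak_compositions r d"
  assume "(\<Prod>l<r. real (p l) ^ (e ! l)) = (\<Prod>l<r. real (p l) ^ (e' ! l))"
  then have "real (\<Prod>l<r. p l ^ (e ! l)) = real (\<Prod>l<r. p l ^ (e' ! l))" by simp
  then have eq: "(\<Prod>l<r. p l ^ (e ! l)) = (\<Prod>l<r. p l ^ (e' ! l))"
    by (simp only: of_nat_eq_iff)
  have mult: "multiplicity (p l) (\<Prod>l<r. p l ^ (f ! l)) = f ! l" if "l < r" for f l
  proof -
    have "(\<Prod>l<r. p l ^ (f ! l)) = (\<Prod>q\<in>p ` {..<r}. q ^ (f ! inv_into UNIV p q))"
      by (subst prod.reindex) (auto intro: inj_on_subset[OF p(1)] simp: inv_f_f[OF p(1)])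
    also have "multiplicity (p l) \<dots> = (if p l \<in> p ` {..<r} then f ! inv_into UNIV p (p l) else 0)"
      using p(2) by (intro multiplicity_prod_prime_powers) auto
    also have "\<dots> = f ! l" using that by (simp add: inv_f_f[OF p(1)])
    finally show ?thesis .
  qed
  have "length e = r" "length e' = r" using e by (auto simp: weak_compositions_def)
  moreover have "e ! l = e' ! l" if "l < r" for l
    using mult[OF that, of e] mult[OF that, of e'] eq by simp
  ultimately show "e = e'" by (intro nth_equalityI) auto
qed

text \<open>
  With \<open>x e\<close> the value at the primes of the monomial with exponents \<open>e\<close>, the entries of the power
  are \<open>\<Sum>e. multinomial e * x e ^ i * x e ^ j\<close>. For a kernel vector \<open>c\<close>, the quadratic form is
  \<open>\<Sum>e. multinomial e * (q e)\<^sup>2 = 0\<close>, where \<open>q e\<close> is the value at \<open>x e\<close> of the polynomial with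
  coefficients \<open>c\<close>. That polynomial has degree less than \<open>s\<close> but at least \<open>s\<close> roots, so \<open>c = 0\<close>.
\<close>

lemma power_sum_hadamard_minor_nonzero:
  fixes A :: "real^'n^'m" and p :: "nat \<Rightarrow> nat"
  assumes p: "inj p" "\<And>l. prime (p l)"
    and A: "\<And>i j. i < s \<Longrightarrow> j < s \<Longrightarrow> A $ \<rho> i $ \<kappa> j = (\<Sum>l<r. real (p l) ^ (i + j))"
    and s: "s \<le> (r + d - 1) choose d"
  shows "hadamard_minor \<rho> \<kappa> s d A \<noteq> 0"
  unfolding hadamard_minor_def
proof (rule det_mat_nonzeroI)
  fix c :: "nat \<Rightarrow> real"
  assume c: "\<And>i. i < s \<Longrightarrow> (\<Sum>j<s. (A $ \<rho> i $ \<kappa> j) ^ d * c j) = 0"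
  let ?E = "weak_compositions r d"
  define x where "x e = (\<Prod>l<r. real (p l) ^ (e ! l))" for e
  define q where "q e = (\<Sum>i<s. c i * x e ^ i)" for e
  have entry: "(A $ \<rho> i $ \<kappa> j) ^ d = (\<Sum>e\<in>?E. real (multinomial e) * (x e ^ i * x e ^ j))"
    if "i < s" "j < s" for i j
  proof -
    have "(\<Prod>l<r. (real (p l) ^ (i + j)) ^ (e ! l)) = x e ^ i * x e ^ j" for e
    proof -
      have "(\<Prod>l<r. (real (p l) ^ (i + j)) ^ (e ! l)) = (\<Prod>l<r. (real (p l) ^ (e ! l)) ^ (i + j))"
        by (intro prod.cong refl) (metis mult.commute power_mult)
      also have "\<dots> = x e ^ (i + j)" by (simp only: x_def prod_power_distrib)
      finally show ?thesis by (simp only: power_add)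
    qed
    then show ?thesis by (simp only: A[OF that] multinomial_theorem)
  qed
  have "0 = (\<Sum>i<s. c i * (\<Sum>j<s. (A $ \<rho> i $ \<kappa> j) ^ d * c j))"
    using c by simp
  also have "\<dots> = (\<Sum>i<s. \<Sum>j<s. \<Sum>e\<in>?E. real (multinomial e) * ((c i * x e ^ i) * (c j * x e ^ j)))"
    by (simp add: sum_distrib_left sum_distrib_right entry mult_ac)
  also have "\<dots> = (\<Sum>i<s. \<Sum>e\<in>?E. \<Sum>j<s. real (multinomial e) * ((c i * x e ^ i) * (c j * x e ^ j)))"
    by (intro sum.cong refl sum.swap)
  also have "\<dots> = (\<Sum>e\<in>?E. \<Sum>i<s. \<Sum>j<s. real (multinomial e) * ((c i * x e ^ i) * (c j * x e ^ j)))"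
    by (rule sum.swap)
  also have "\<dots> = (\<Sum>e\<in>?E. real (multinomial e) * (q e * q e))"
    unfolding q_def sum_product by (simp only: sum_distrib_left)
  finally have "(\<Sum>e\<in>?E. real (multinomial e) * (q e * q e)) = 0" by simp
  then have "real (multinomial e) * (q e * q e) = 0" if "e \<in> ?E" for e
    using that by (subst (asm) sum_nonneg_eq_0_iff) (auto simp: finite_weak_compositions)
  then have q0: "q e = 0" if "e \<in> ?E" for e
    using that multinomial_pos[of e] by fastforce
  show "\<forall>j<s. c j = 0"
  proof (rule ccontr)
    assume "\<not> (\<forall>j<s. c j = 0)"
    then obtain j where j: "j < s" "c j \<noteq> 0" by blast
    then obtain n where n: "s = Suc n" by (cases s) auto
    have bound: "finite {z. (\<Sum>i\<le>n. c i * z ^ i) = 0} \<and> card {z. (\<Sum>i\<le>n. c i * z ^ i) = 0} \<le> n"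
      using j n by (intro Poly_Roots.polyfun_rootbound exI[of _ j]) auto
    have "x ` ?E \<subseteq> {z. (\<Sum>i\<le>n. c i * z ^ i) = 0}"
      using q0 by (auto simp: q_def n lessThan_Suc_atMost)
    then have "card (x ` ?E) \<le> n"
      using bound card_mono order_trans by blast
    moreover have "card (x ` ?E) = card ?E"
      unfolding x_def by (intro card_image inj_on_prime_monomials p)
    ultimately show False using s n by (simp add: card_weak_compositions)
  qed
qed

section \<open>Matrix entries with distinct transversal products\<close>

text \<open>
  These are the moduli of Goedel's beta function. A common prime divides \<open>fact N * (b - a)\<close>, where \<open>a < b\<close> say, and
  every prime factor of \<open>b - a \<le> N\<close> also divides \<open>fact N\<close>; but a prime factor of
  \<open>1 + fact N * a\<close> cannot divide \<open>fact N\<close>.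
\<close>

lemma coprime_beta_moduli:
  fixes a b N :: nat
  assumes "a \<le> N" "b \<le> N" "a \<noteq> b"
  shows "coprime (1 + fact N * a) (1 + fact N * b)"
  using assms
proof (induction a b rule: linorder_wlog)
  case (le a b)
  show ?case
  proof (rule ccontr)
    assume "\<not> ?thesis"
    then obtain q where q: "prime q" "q dvd 1 + fact N * a" "q dvd 1 + fact N * b"
      using prime_factor_nat[of "gcd (1 + fact N * a) (1 + fact N * b)"]
      by (auto simp: coprime_iff_gcd_eq_1)
    have "q dvd (1 + fact N * b) - (1 + fact N * a)" by (intro dvd_diff_nat q)
    also have "\<dots> = fact N * (b - a)" by (simp add: diff_mult_distrib2)
    finally have "q dvd fact N \<or> q dvd b - a" using q prime_dvd_mult_iff by blast
    moreover have "q dvd fact N" if "q dvd b - a"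
    proof -
      have "q \<le> b - a" using that le by (intro dvd_imp_le) auto
      then show ?thesis using le q by (intro dvd_fact) (auto dest: prime_ge_1_nat)
    qed
    ultimately have "q dvd fact N * a" by auto
    with q(2) have "q dvd 1" using dvd_add_left_iff by blast
    with q(1) show False by auto
  qed
next
  case (sym a b)
  then show ?case by (auto simp: coprime_commute)
qed

text \<open>
  The entries are pairwise coprime and greater than 1. If the permutations differ at \<open>i\<close>, the entry
  \<open>a i (\<sigma> i)\<close> divides the first product but is coprime to the second. Being the
  sum of a function of \<open>i\<close> and a function of \<open>j\<close>, the entries form a matrix of rank at most 2.
\<close>

lemma distinct_transversals_witness:
  fixes s :: nat
  assumes \<sigma>: "\<sigma> permutes {..<s}" and \<tau>: "\<tau> permutes {..<s}" and ne: "\<sigma> \<noteq> \<tau>"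
  defines "a \<equiv> \<lambda>i j. 1 + fact (s * s) * (i * s + j + 1)"
  shows "(\<Prod>i<s. a i (\<sigma> i)) \<noteq> (\<Prod>i<s. a i (\<tau> i))"
proof
  assume eq: "(\<Prod>i<s. a i (\<sigma> i)) = (\<Prod>i<s. a i (\<tau> i))"
  obtain i where i: "i < s" "\<sigma> i \<noteq> \<tau> i"
    using permutes_not_in[OF \<sigma>] permutes_not_in[OF \<tau>] ne by (metis ext lessThan_iff)
  have lt: "\<sigma> i < s" "\<And>j. j < s \<Longrightarrow> \<tau> j < s"
    using i \<sigma> \<tau> by (auto dest: permutes_in_image)
  have bound: "k * s + l + 1 \<le> s * s" if "k < s" "l < s" for k l
  proof -
    have "k * s + l + 1 \<le> (k + 1) * s" using that by simp
    also have "\<dots> \<le> s * s" using that by (intro mult_right_mono) auto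
    finally show ?thesis .
  qed
  have "coprime (a i (\<sigma> i)) (a j (\<tau> j))" if "j < s" for j
  proof -
    have "i * s + \<sigma> i \<noteq> j * s + \<tau> j"
    proof
      assume *: "i * s + \<sigma> i = j * s + \<tau> j"
      then have "(i * s + \<sigma> i) div s = (j * s + \<tau> j) div s" by simp
      then have "i = j" using lt that i by simp
      with * i show False by simp
    qed
    then show ?thesis
      unfolding a_def by (intro coprime_beta_moduli bound lt i that) auto
  qed
  then have "coprime (a i (\<sigma> i)) (\<Prod>i<s. a i (\<tau> i))"
    by (intro prod_coprime_right) auto
  moreover have "a i (\<sigma> i) dvd (\<Prod>i<s. a i (\<sigma> i))"
    using i by (intro dvd_prodI) auto
  ultimately have "is_unit (a i (\<sigma> i))"
    unfolding eq using coprime_absorb_left by blast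
  then show False by (simp add: a_def)
qed

section \<open>Perturbation along polynomial paths\<close>

lemma real_polynomial_function_entry: "real_polynomial_function (\<lambda>A. A $ i $ j :: real)"
  by (intro real_polynomial_function.intros(1) bounded_linear_compose[OF bounded_linear_vec_nth]
      bounded_linear_vec_nth)

lemma real_polynomial_function_transversal_product:
  "real_polynomial_function (transversal_product \<rho> \<kappa> s \<sigma>)"
  unfolding transversal_product_def[abs_def]
  by (intro real_polynomial_function_prod real_polynomial_function_entry) auto

lemma real_polynomial_function_hadamard_minor:
  "real_polynomial_function (hadamard_minor \<rho> \<kappa> s d)"
  unfolding hadamard_minor_expansion[abs_def]
  by (intro real_polynomial_function_sum real_polynomial_function.intros(2,4)
      real_polynomial_function_power real_polynomial_function_transversal_product)
     (auto intro: finite_permutations)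

definition outer_product_sum ::
    "nat \<Rightarrow> ('m \<Rightarrow> nat \<Rightarrow> real) \<Rightarrow> ('n \<Rightarrow> nat \<Rightarrow> real) \<Rightarrow> real^'n^'m" where
  "outer_product_sum r U V = (\<chi> i j. \<Sum>l<r. U i l * V j l)"

text \<open>
  The path interpolates linearly between the factors, so it stays inside the matrices of rank at
  most \<open>r\<close> and its entries are quadratic polynomials in the parameter. Each \<open>g\<close> is nonzero at one
  of its ends and so has finitely many zeros on it; a short initial interval is uncountable.
\<close>

lemma generic_outer_product_sum:
  fixes G :: "(real^'n^'m \<Rightarrow> real) set"
  assumes G: "countable G" "\<And>g. g \<in> G \<Longrightarrow> real_polynomial_function g"
    and wit: "\<And>g. g \<in> G \<Longrightarrow> g (outer_product_sum r U V) \<noteq> 0 \<or> g (outer_product_sum r U\<^sub>1 V\<^sub>1) \<noteq> 0"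
    and \<epsilon>: "\<epsilon> > 0"
  obtains U' V' where "dist (outer_product_sum r U' V') (outer_product_sum r U V :: real^'n^'m) < \<epsilon>"
    and "\<forall>g\<in>G. g (outer_product_sum r U' V') \<noteq> 0"
proof -
  define Ut where "Ut t i l = U i l + t * (U\<^sub>1 i l - U i l)" for t i l
  define Vt where "Vt t j l = V j l + t * (V\<^sub>1 j l - V j l)" for t j l
  define F :: "real \<Rightarrow> real^'n^'m" where "F t = outer_product_sum r (Ut t) (Vt t)" for t
  have F0: "F 0 = outer_product_sum r U V" and F1: "F 1 = outer_product_sum r U\<^sub>1 V\<^sub>1"
    by (simp_all add: F_def Ut_def Vt_def outer_product_sum_def)
  have lin: "real_polynomial_function (\<lambda>t. a + t * b)" for a b :: real
    by (intro real_polynomial_function.intros bounded_linear_ident)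
  have polyF: "polynomial_function F"
    unfolding polynomial_function_iff_Basis_inner
    by (auto simp: Basis_vec_def inner_axis F_def outer_product_sum_def Ut_def Vt_def
        intro!: real_polynomial_function_sum real_polynomial_function.intros(4) lin)
  have zeros: "countable {t. g (F t) = 0}" if g: "g \<in> G" for g
  proof -
    have "real_polynomial_function (g \<circ> F)"
      by (rule real_polynomial_function_compose[OF polyF G(2)[OF g]])
    then obtain a n where an: "g \<circ> F = (\<lambda>t. \<Sum>i\<le>n. a i * t ^ i)"
      unfolding real_polynomial_function_iff_sum by blast
    have gF: "g (F t) = (\<Sum>i\<le>n. a i * t ^ i)" for t
      using fun_cong[OF an, of t] by simp
    have "\<exists>t. g (F t) \<noteq> 0" using wit[OF g] F0 F1 by metis
    moreover have "g (F t) = 0" if "\<not> (\<exists>k\<le>n. a k \<noteq> 0)" for t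
      using that by (simp add: gF)
    ultimately have "\<exists>k\<le>n. a k \<noteq> 0" by blast
    then have "finite {t. (\<Sum>i\<le>n. a i * t ^ i) = 0}"
      using Poly_Roots.polyfun_rootbound by blast
    then show ?thesis unfolding gF by (rule countable_finite)
  qed
  have "continuous (at 0) F" by (rule continuous_polymonial_function[OF polyF])
  then obtain \<delta> where \<delta>: "\<delta> > 0" "\<And>t. dist t 0 < \<delta> \<Longrightarrow> dist (F t) (F 0) < \<epsilon>"
    using \<epsilon> unfolding continuous_at_eps_delta by (auto simp: dist_norm) 
  have "countable (\<Union>g\<in>G. {t. g (F t) = 0})"
    using G(1) zeros by blast
  moreover have "uncountable {0<..<\<delta>}" using \<delta>(1) by (simp add: uncountable_open_interval)
  ultimately have "\<not> {0<..<\<delta>} \<subseteq> (\<Union>g\<in>G. {t. g (F t) = 0})"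
    using countable_subset by blast
  then obtain t where "t \<in> {0<..<\<delta>}" "t \<notin> (\<Union>g\<in>G. {t. g (F t) = 0})" by blast
  then have t: "0 < t" "t < \<delta>" "\<And>g. g \<in> G \<Longrightarrow> g (F t) \<noteq> 0" by auto
  show ?thesis
    using that[of "Ut t" "Vt t"] \<delta>(2)[of t] t F0 by (auto simp: F_def)
qed

section \<open>Neighbourhoods that serve all large exponents\<close>

definition distinct_transversals ::
    "(nat \<Rightarrow> 'm) \<Rightarrow> (nat \<Rightarrow> 'n) \<Rightarrow> nat \<Rightarrow> real^'n^'m \<Rightarrow> bool" where
  "distinct_transversals \<rho> \<kappa> s A \<longleftrightarrow>
    (\<forall>\<sigma> \<tau>. \<sigma> permutes {..<s} \<longrightarrow> \<tau> permutes {..<s} \<longrightarrow> \<sigma> \<noteq> \<tau> \<longrightarrow>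
      \<bar>transversal_product \<rho> \<kappa> s \<sigma> A\<bar> \<noteq> \<bar>transversal_product \<rho> \<kappa> s \<tau> A\<bar>)"

text \<open>
  Let \<open>\<mu>\<close> be the permutation with the largest product at \<open>A\<close>. Near \<open>A\<close> its product stays above some
  \<open>b\<close> in absolute value and all others below some \<open>a < b\<close>. Once \<open>b ^ d\<close> exceeds the number of
  permutations times \<open>a ^ d\<close>, the term of \<open>\<mu>\<close> in the Leibniz formula cannot be cancelled. The
  single nonzero minor at \<open>A\<close> ensures that the largest product is not zero, which has to be checked
  when there is only one transversal.
\<close>

lemma dominant_transversal_neighbourhood:
  fixes A :: "real^'n^'m"
  assumes dist: "distinct_transversals \<rho> \<kappa> s A"
    and nz: "hadamard_minor \<rho> \<kappa> s d\<^sub>0 A \<noteq> 0" "d\<^sub>0 \<ge> 1"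
  obtains S D where "open S" "A \<in> S"
    "\<forall>B\<in>S. \<forall>d\<ge>D. hadamard_minor \<rho> \<kappa> s d B \<noteq> 0"
proof -
  let ?P = "{\<sigma>. \<sigma> permutes {..<s}}" and ?t = "transversal_product \<rho> \<kappa> s"
  have fin: "finite ?P" by (simp add: finite_permutations)
  have "id \<in> ?P" by (simp add: permutes_id)
  then obtain \<mu> where \<mu>: "\<mu> \<in> ?P" "\<And>\<sigma>. \<sigma> \<in> ?P \<Longrightarrow> \<bar>?t \<sigma> A\<bar> \<le> \<bar>?t \<mu> A\<bar>"
    using fin Max_in[of "(\<lambda>\<sigma>. \<bar>?t \<sigma> A\<bar>) ` ?P"] Max_ge[of "(\<lambda>\<sigma>. \<bar>?t \<sigma> A\<bar>) ` ?P"]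
    by (smt (verit) empty_iff finite_imageI imageE imageI image_is_empty)
  let ?Q = "?P - {\<mu>}"
  have less: "\<bar>?t \<sigma> A\<bar> < \<bar>?t \<mu> A\<bar>" if "\<sigma> \<in> ?Q" for \<sigma>
    using \<mu> dist that by (force simp: distinct_transversals_def order.strict_iff_order)
  have pos: "\<bar>?t \<mu> A\<bar> > 0"
  proof (rule ccontr)
    assume "\<not> ?thesis"
    then have "?t \<sigma> A = 0" if "\<sigma> \<in> ?P" for \<sigma> using \<mu>(2)[OF that] by simp
    then have "hadamard_minor \<rho> \<kappa> s d\<^sub>0 A = 0"
      using nz(2) by (simp add: hadamard_minor_expansion zero_power)
    with nz(1) show False ..
  qed
  \<comment> \<open>Inserting 0 covers the case of a single permutation and keeps \<open>a\<close> positive.\<close>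
  define L where "L = Max (insert 0 ((\<lambda>\<sigma>. \<bar>?t \<sigma> A\<bar>) ` ?Q))"
  have "L < \<bar>?t \<mu> A\<bar>"
    unfolding L_def using fin pos less by (subst Max_less_iff) auto
  then obtain a where a: "L < a" "a < \<bar>?t \<mu> A\<bar>" using dense by blast
  then obtain b where b: "a < b" "b < \<bar>?t \<mu> A\<bar>" using dense by blast
  have La: "\<bar>?t \<sigma> A\<bar> < a" if "\<sigma> \<in> ?Q" for \<sigma>
  proof -
    have "\<bar>?t \<sigma> A\<bar> \<le> L" unfolding L_def using fin that by (intro Max_ge) auto
    with a show ?thesis by simp
  qed
  have "0 \<le> L" unfolding L_def using fin by (intro Max_ge) auto
  with a b have ab: "0 < a" "0 < b" by auto
  have "(\<lambda>d. real (card ?P) * (a / b) ^ d) \<longlonglongrightarrow> real (card ?P) * 0"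
    using ab b by (intro tendsto_mult tendsto_const LIMSEQ_power_zero) auto
  then have "eventually (\<lambda>d. real (card ?P) * (a / b) ^ d < 1) sequentially"
    by (rule order_tendstoD(2)) simp
  then obtain D where D: "\<And>d. d \<ge> D \<Longrightarrow> real (card ?P) * (a / b) ^ d < 1"
    unfolding eventually_sequentially by blast
  define S where "S = {B. b < \<bar>?t \<mu> B\<bar>} \<inter> (\<Inter>\<sigma>\<in>?Q. {B. \<bar>?t \<sigma> B\<bar> < a})"
  have cont: "continuous_on UNIV (?t \<sigma>)" for \<sigma>
    by (intro continuous_at_imp_continuous_on ballI continuous_real_polymonial_function
        real_polynomial_function_transversal_product)
  have "open S"
    unfolding S_def using fin
    by (intro open_Int open_INT ballI open_Collect_less continuous_intros cont) auto
  moreover have "A \<in> S" using b La by (auto simp: S_def)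
  moreover have "hadamard_minor \<rho> \<kappa> s d B \<noteq> 0" if B: "B \<in> S" and d: "d \<ge> D" for B d
  proof
    assume 0: "hadamard_minor \<rho> \<kappa> s d B = 0"
    let ?f = "\<lambda>\<sigma>. of_int (sign \<sigma>) * ?t \<sigma> B ^ d"
    have abs_f: "\<bar>?f \<sigma>\<bar> = \<bar>?t \<sigma> B\<bar> ^ d" for \<sigma>
      by (simp add: abs_mult power_abs sign_def)
    have "?f \<mu> + sum ?f ?Q = 0"
      using 0 sum.remove[OF fin \<mu>(1), of ?f] by (simp add: hadamard_minor_expansion)
    then have "\<bar>?f \<mu>\<bar> = \<bar>sum ?f ?Q\<bar>" by linarith
    also have "\<dots> \<le> (\<Sum>\<sigma>\<in>?Q. \<bar>?f \<sigma>\<bar>)" by (rule sum_abs)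
    also have "\<dots> \<le> (\<Sum>\<sigma>\<in>?Q. a ^ d)"
      unfolding abs_f using B by (intro sum_mono power_mono) (auto simp: S_def less_imp_le)
    also have "\<dots> \<le> real (card ?P) * a ^ d"
      using ab fin by (auto intro!: mult_right_mono card_mono)
    also have "\<dots> = real (card ?P) * (a / b) ^ d * b ^ d"
      using ab by (simp add: power_divide)
    also have "\<dots> < 1 * b ^ d" using D[OF d] ab by (intro mult_strict_right_mono) auto
    also have "\<dots> \<le> \<bar>?t \<mu> B\<bar> ^ d" using B ab by (auto simp: S_def intro!: power_mono)
    finally show False by (simp add: abs_f)
  qed
  ultimately show ?thesis by (intro that[of S D]) auto
qed

text \<open>
  For \<open>r \<ge> 2\<close> the binomial coefficient is at least \<open>d + 1\<close>; for \<open>r \<le> 1\<close> it equals \<open>r\<close>.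
\<close>

lemma min_binomial_eventually_constant:
  fixes r k d :: nat
  assumes "r \<le> k" "1 \<le> d" "k \<le> d"
  shows "min ((r + d - 1) choose d) k = (if r \<le> 1 then r else k)"
proof (cases "r \<le> 1")
  case True
  then consider "r = 0" | "r = 1" by linarith
  then show ?thesis using assms by cases (auto simp: binomial_eq_0)
next
  case False
  have "(d + 1) choose d \<le> (r + d - 1) choose d"
    using False by (intro binomial_right_mono) auto
  then show ?thesis using False assms by simp
qed

section \<open>The generic matrices are open and dense\<close>

text \<open>
  Here \<open>sz d\<close> is the order of the minor for the exponent \<open>d\<close>, and \<open>s\<close> is meant to be its eventual
  value, the only order at which transversal products have to be compared.
\<close>

definition hadamard_generic ::
    "(nat \<Rightarrow> 'm) \<Rightarrow> (nat \<Rightarrow> 'n) \<Rightarrow> nat \<Rightarrow> (nat \<Rightarrow> nat) \<Rightarrow> (real^'n^'m) set" where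
  "hadamard_generic \<rho> \<kappa> s sz =
    {A. distinct_transversals \<rho> \<kappa> s A \<and> (\<forall>d\<ge>1. hadamard_minor \<rho> \<kappa> (sz d) d A \<noteq> 0)}"

lemma continuous_on_real_polynomial_function:
  "real_polynomial_function f \<Longrightarrow> continuous_on S f"
  by (intro continuous_at_imp_continuous_on ballI continuous_real_polymonial_function)

lemma open_hadamard_generic:
  fixes \<rho> :: "nat \<Rightarrow> 'm::finite" and \<kappa> :: "nat \<Rightarrow> 'n::finite"
  assumes sz: "\<And>d. d \<ge> D \<Longrightarrow> sz d = s"
  shows "open (hadamard_generic \<rho> \<kappa> s sz)"
proof (subst open_subopen, intro ballI)
  fix A assume A: "A \<in> hadamard_generic \<rho> \<kappa> s sz"
  let ?t = "transversal_product \<rho> \<kappa> s"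
  have nz: "hadamard_minor \<rho> \<kappa> s (max 1 D) A \<noteq> 0"
    using A sz[of "max 1 D"] by (auto simp: hadamard_generic_def dest: spec[of _ "max 1 D"])
  obtain S D' where S: "open S" "A \<in> S"
      "\<forall>B\<in>S. \<forall>d\<ge>D'. hadamard_minor \<rho> \<kappa> s d B \<noteq> 0"
    using A by (auto simp: hadamard_generic_def
        intro: dominant_transversal_neighbourhood[OF _ nz max.cobounded1])
  define Q where "Q = {(\<sigma>, \<tau>). \<sigma> permutes {..<s} \<and> \<tau> permutes {..<s} \<and> \<sigma> \<noteq> \<tau>}"
  have "Q \<subseteq> {\<sigma>. \<sigma> permutes {..<s}} \<times> {\<sigma>. \<sigma> permutes {..<s}}" by (auto simp: Q_def)
  then have finQ: "finite Q" by (rule finite_subset) (simp add: finite_permutations)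
  define T where "T = S \<inter> (\<Inter>(\<sigma>, \<tau>)\<in>Q. {B. \<bar>?t \<sigma> B\<bar> \<noteq> \<bar>?t \<tau> B\<bar>})
      \<inter> (\<Inter>d\<in>{1..max D D'}. {B. hadamard_minor \<rho> \<kappa> (sz d) d B \<noteq> 0})"
  have "open T"
    unfolding T_def case_prod_unfold
    by (intro open_Int open_INT ballI finQ S finite_atLeastAtMost open_Collect_neq
        continuous_on_rabs continuous_on_const continuous_on_real_polynomial_function
        real_polynomial_function_transversal_product real_polynomial_function_hadamard_minor)
  moreover have "A \<in> T"
    using A S(2) by (auto simp: T_def Q_def hadamard_generic_def distinct_transversals_def)
  moreover have "T \<subseteq> hadamard_generic \<rho> \<kappa> s sz"
  proof
    fix B assume B: "B \<in> T"
    have "hadamard_minor \<rho> \<kappa> (sz d) d B \<noteq> 0" if "d \<ge> 1" for d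
    proof (cases "d \<le> max D D'")
      case True
      then show ?thesis using B that by (auto simp: T_def)
    next
      case False
      then show ?thesis using B S(3) sz[of d] by (auto simp: T_def)
    qed
    then show "B \<in> hadamard_generic \<rho> \<kappa> s sz"
      using B by (auto simp: hadamard_generic_def distinct_transversals_def T_def Q_def)
  qed
  ultimately show "\<exists>T. open T \<and> A \<in> T \<and> T \<subseteq> hadamard_generic \<rho> \<kappa> s sz" by blast
qed

text \<open>
  For \<open>s \<le> 1\<close> there is only one permutation. Otherwise the two summands of the entry
  \<open>(1 + F * (i * s + 1)) * 1 + F * j\<close> are the two outer products that \<open>r \<ge> 2\<close> makes available.
\<close>

lemma ex_distinct_transversal_products:
  fixes \<rho> :: "nat \<Rightarrow> 'm::finite" and \<kappa> :: "nat \<Rightarrow> 'n::finite"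
  assumes inj: "inj_on \<rho> {..<s}" "inj_on \<kappa> {..<s}" and rs: "s \<le> 1 \<or> 2 \<le> r"
  obtains U V where "distinct_transversals \<rho> \<kappa> s (outer_product_sum r U V)"
proof (cases "s \<le> 1")
  case True
  then consider "{..<s} = {}" | "{..<s} = {0}"
    by (metis One_nat_def lessThan_0 lessThan_Suc le_Suc_eq le_zero_eq insert_is_Un sup_bot_right)
  then have "\<sigma> = \<tau>" if "\<sigma> permutes {..<s}" "\<tau> permutes {..<s}" for \<sigma> \<tau>
    using that by cases (auto simp: permutes_sing)
  then show ?thesis using that unfolding distinct_transversals_def by blast
next
  case False
  then have r: "2 \<le> r" using rs by auto
  let ?row = "inv_into {..<s} \<rho>" and ?col = "inv_into {..<s} \<kappa>"
  define F :: nat where "F = fact (s * s)"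
  define a where "a i j = 1 + F * (i * s + j + 1)" for i j
  define U where "U x l = (if l = 0 then real (1 + F * (?row x * s + 1)) else if l = 1 then real F else 0)"
    for x and l :: nat
  define V where "V y l = (if l = 0 then 1 else if l = 1 then real (?col y) else 0)"
    for y and l :: nat
  let ?A = "outer_product_sum r U V"
  have entry: "?A $ \<rho> i $ \<kappa> j = real (a i j)" if "i < s" "j < s" for i j
  proof -
    have "?A $ \<rho> i $ \<kappa> j = (\<Sum>l<r. U (\<rho> i) l * V (\<kappa> j) l)" by (simp add: outer_product_sum_def)
    also have "\<dots> = (\<Sum>l\<in>{0, 1}. U (\<rho> i) l * V (\<kappa> j) l)"
      using r by (intro sum.mono_neutral_right) (auto simp: U_def)
    also have "\<dots> = real (a i j)"
      using that by (simp add: U_def V_def a_def inv_into_f_f[OF inj(1)] inv_into_f_f[OF inj(2)]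
          algebra_simps)
    finally show ?thesis .
  qed
  have tp: "transversal_product \<rho> \<kappa> s \<sigma> ?A = real (\<Prod>i<s. a i (\<sigma> i))"
    if "\<sigma> permutes {..<s}" for \<sigma>
    using permutes_in_image[OF that]
    by (auto simp: transversal_product_def entry intro!: prod.cong)
  show ?thesis
  proof (rule that, unfold distinct_transversals_def, intro allI impI)
    fix \<sigma> \<tau> assume st: "\<sigma> permutes {..<s}" "\<tau> permutes {..<s}" "\<sigma> \<noteq> \<tau>"
    have "(\<Prod>i<s. a i (\<sigma> i)) \<noteq> (\<Prod>i<s. a i (\<tau> i))"
      using distinct_transversals_witness[OF st] unfolding a_def F_def .
    then show "\<bar>transversal_product \<rho> \<kappa> s \<sigma> ?A\<bar> \<noteq> \<bar>transversal_product \<rho> \<kappa> s \<tau> ?A\<bar>"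
      unfolding tp[OF st(1)] tp[OF st(2)] abs_of_nat of_nat_eq_iff .
  qed
qed

lemma ex_hadamard_minors_nonzero:
  fixes \<rho> :: "nat \<Rightarrow> 'm::finite" and \<kappa> :: "nat \<Rightarrow> 'n::finite"
  assumes inj: "inj_on \<rho> {..<k}" "inj_on \<kappa> {..<k}"
  obtains U V where
    "\<forall>d. hadamard_minor \<rho> \<kappa> (min ((r + d - 1) choose d) k) d (outer_product_sum r U V) \<noteq> 0"
proof -
  obtain p :: "nat \<Rightarrow> nat" where p: "inj p" "\<And>l. prime (p l)"
    using infinite_countable_subset[OF primes_infinite] by (auto simp: image_subset_iff)
  define U where "U x l = real (p l) ^ inv_into {..<k} \<rho> x" for x l
  define V where "V y l = real (p l) ^ inv_into {..<k} \<kappa> y" for y l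
  show ?thesis
    by (rule that[of U V], rule allI, rule power_sum_hadamard_minor_nonzero[OF p _ min.cobounded1])
       (simp add: outer_product_sum_def U_def V_def power_add
          inv_into_f_f[OF inj(1)] inv_into_f_f[OF inj(2)])
qed

text \<open>
  The first perturbation separates the transversal products. The second path starts at the result,
  where these conditions hold, and leads to the power-sum matrix, where the minor conditions hold, so
  all of them can be met at once on it. The rank cannot drop on the way: the minor condition for
  \<open>d = 1\<close> has order \<open>r\<close>.
\<close>

lemma hadamard_generic_dense:
  fixes A :: "real^'n^'m"
  assumes r: "rank A = r" "r \<le> k" and inj: "inj_on \<rho> {..<k}" "inj_on \<kappa> {..<k}" and \<epsilon>: "\<epsilon> > 0"
    and s: "s \<le> k" "s \<le> 1 \<or> 2 \<le> r"
  obtains B where "rank B = r" "dist B A < \<epsilon>"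
    "B \<in> hadamard_generic \<rho> \<kappa> s (\<lambda>d. min ((r + d - 1) choose d) k)"
proof -
  let ?t = "transversal_product \<rho> \<kappa> s" and ?sz = "\<lambda>d. min ((r + d - 1) choose d) k"
  have inj_s: "inj_on \<rho> {..<s}" "inj_on \<kappa> {..<s}"
    using inj s(1) by (auto elim: inj_on_subset)
  obtain U V where "A = (\<chi> i j. \<Sum>l<rank A. U i l * V j l)"
    by (rule rank_factorization)
  then have UV: "A = outer_product_sum r U V"
    by (simp only: r(1) outer_product_sum_def)
  obtain U\<^sub>1 V\<^sub>1 where wit\<^sub>1: "distinct_transversals \<rho> \<kappa> s (outer_product_sum r U\<^sub>1 V\<^sub>1)"
    by (rule ex_distinct_transversal_products[OF inj_s s(2)])
  obtain U\<^sub>2 V\<^sub>2 where wit\<^sub>2: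
    "\<forall>d. hadamard_minor \<rho> \<kappa> (?sz d) d (outer_product_sum r U\<^sub>2 V\<^sub>2) \<noteq> 0"
    by (rule ex_hadamard_minors_nonzero[OF inj])
  define Q where "Q = {(\<sigma>, \<tau>). \<sigma> permutes {..<s} \<and> \<tau> permutes {..<s} \<and> \<sigma> \<noteq> \<tau>}"
  \<comment> \<open>Squares make the comparison of absolute values polynomial.\<close>
  define g where "g = (\<lambda>(\<sigma>, \<tau>) B. (?t \<sigma> B)\<^sup>2 - (?t \<tau> B)\<^sup>2)"
  have "Q \<subseteq> {\<sigma>. \<sigma> permutes {..<s}} \<times> {\<sigma>. \<sigma> permutes {..<s}}" by (auto simp: Q_def)
  then have finQ: "finite Q" by (rule finite_subset) (simp add: finite_permutations)
  have g_iff: "g (\<sigma>, \<tau>) B = 0 \<longleftrightarrow> \<bar>?t \<sigma> B\<bar> = \<bar>?t \<tau> B\<bar>" for \<sigma> \<tau> B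
    by (simp add: g_def power2_eq_iff abs_eq_iff)
  have poly_g: "real_polynomial_function f" if "f \<in> g ` Q" for f
    using that by (auto simp: g_def intro!: real_polynomial_function_diff
        real_polynomial_function_power real_polynomial_function_transversal_product)
  have half: "\<epsilon> / 2 > 0" using \<epsilon> by simp
  obtain U' V' where step\<^sub>1:
      "dist (outer_product_sum r U' V') (outer_product_sum r U V :: real^'n^'m) < \<epsilon> / 2"
      "\<forall>f\<in>g ` Q. f (outer_product_sum r U' V') \<noteq> 0"
  proof (rule generic_outer_product_sum[OF _ poly_g _ half, of "g ` Q" r U V U\<^sub>1 V\<^sub>1])
    show "countable (g ` Q)" using finQ by (simp add: countable_finite)
    show "f (outer_product_sum r U V) \<noteq> 0 \<or> f (outer_product_sum r U\<^sub>1 V\<^sub>1) \<noteq> 0" if "f \<in> g ` Q" for f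
      using that wit\<^sub>1 by (auto simp: g_iff Q_def distinct_transversals_def)
  qed (assumption, erule (1) that)
  define G where "G = g ` Q \<union> (\<lambda>d. hadamard_minor \<rho> \<kappa> (?sz d) d) ` UNIV"
  have poly_G: "real_polynomial_function f" if "f \<in> G" for f
    using that poly_g real_polynomial_function_hadamard_minor by (auto simp: G_def)
  obtain U'' V'' where step\<^sub>2:
      "dist (outer_product_sum r U'' V'') (outer_product_sum r U' V' :: real^'n^'m) < \<epsilon> / 2"
      "\<forall>f\<in>G. f (outer_product_sum r U'' V'') \<noteq> 0"
  proof (rule generic_outer_product_sum[OF _ poly_G _ half, of G r U' V' U\<^sub>2 V\<^sub>2])
    show "countable G" unfolding G_def using finQ by (simp add: countable_finite)
    show "f (outer_product_sum r U' V') \<noteq> 0 \<or> f (outer_product_sum r U\<^sub>2 V\<^sub>2) \<noteq> 0" if "f \<in> G" for f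
      using that step\<^sub>1(2) wit\<^sub>2 unfolding G_def by blast
  qed (assumption, erule (1) that)
  define B where "B = (outer_product_sum r U'' V'' :: real^'n^'m)"
  have minor: "hadamard_minor \<rho> \<kappa> (?sz d) d B \<noteq> 0" for d
    using step\<^sub>2(2) unfolding G_def B_def by blast
  have "?sz 1 = r" using r(2) by simp
  then have "r \<le> rank (hadamard_power B 1)"
    using hadamard_minor_le_rank[OF minor[of 1]] by simp
  moreover have "rank (hadamard_power B 1) \<le> (r + 1 - 1) choose 1"
    by (rule rank_hadamard_power_le) (simp add: B_def outer_product_sum_def)
  ultimately have "rank B = r" by (simp only: hadamard_power_1) simp
  moreover have "dist B A < \<epsilon>"
    using dist_triangle[of B A "outer_product_sum r U' V'"] step\<^sub>1(1) step\<^sub>2(1)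
    unfolding B_def UV by linarith
  moreover have "distinct_transversals \<rho> \<kappa> s B"
    unfolding distinct_transversals_def
  proof (intro allI impI)
    fix \<sigma> \<tau> assume "\<sigma> permutes {..<s}" "\<tau> permutes {..<s}" "\<sigma> \<noteq> \<tau>"
    then have "g (\<sigma>, \<tau>) \<in> G" by (auto simp: G_def Q_def)
    then show "\<bar>?t \<sigma> B\<bar> \<noteq> \<bar>?t \<tau> B\<bar>" using step\<^sub>2(2) g_iff unfolding B_def by blast
  qed
  ultimately show ?thesis
    using minor by (intro that[of B]) (auto simp: hadamard_generic_def)
qed

theorem theorem4p5:
  fixes r :: nat
  assumes "r \<le> min CARD('m::finite) CARD('n::finite)"
  shows "\<exists>\<A> :: (real^'n^'m) set.
    openin (top_of_set (rank_stratum r)) \<A> \<and>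
    top_of_set (rank_stratum r) closure_of \<A> = rank_stratum r \<and>
    (\<forall>A\<in>\<A>. \<forall>d\<ge>1. rank (hadamard_power A d) =
       Min {(r + d - 1) choose d, CARD('n), CARD('m)})"
proof -
  define k where "k = min CARD('m) CARD('n)"
  define s where "s = (if r \<le> 1 then r else k)"
  let ?M = "rank_stratum r :: (real^'n^'m) set"
  let ?sz = "\<lambda>d. min ((r + d - 1) choose d) k"
  obtain \<rho> :: "nat \<Rightarrow> 'm" where "bij_betw \<rho> {0..<CARD('m)} UNIV"
    using ex_bij_betw_nat_finite[of "UNIV :: 'm set"] by auto
  then have \<rho>: "inj_on \<rho> {..<k}"
    by (auto simp: bij_betw_def k_def elim!: inj_on_subset)
  obtain \<kappa> :: "nat \<Rightarrow> 'n" where "bij_betw \<kappa> {0..<CARD('n)} UNIV"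
    using ex_bij_betw_nat_finite[of "UNIV :: 'n set"] by auto
  then have \<kappa>: "inj_on \<kappa> {..<k}"
    by (auto simp: bij_betw_def k_def elim!: inj_on_subset)
  have rk: "r \<le> k" using assms by (simp add: k_def)
  have s: "s \<le> k" "s \<le> 1 \<or> 2 \<le> r" using rk by (auto simp: s_def)
  let ?T = "hadamard_generic \<rho> \<kappa> s ?sz"
  have "openin (top_of_set ?M) (?M \<inter> ?T)"
  proof (rule openin_open_Int, rule open_hadamard_generic)
    fix d assume "max 1 k \<le> d"
    then show "?sz d = s"
      unfolding s_def by (intro min_binomial_eventually_constant rk) auto
  qed
  moreover have "top_of_set ?M closure_of (?M \<inter> ?T) = ?M"
  proof -
    have "A \<in> closure (?M \<inter> ?T)" if "A \<in> ?M" for A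
      unfolding closure_approachable
    proof (intro allI impI)
      fix \<epsilon> :: real assume "\<epsilon> > 0"
      have "rank A = r" using that by (simp add: rank_stratum_def)
      then obtain B where "rank B = r" "dist B A < \<epsilon>" "B \<in> ?T"
        by (rule hadamard_generic_dense[OF _ rk \<rho> \<kappa> \<open>\<epsilon> > 0\<close> s])
      then show "\<exists>B\<in>?M \<inter> ?T. dist B A < \<epsilon>" by (auto simp: rank_stratum_def)
    qed
    then show ?thesis by (auto simp: closure_of_subtopology)
  qed
  moreover have "rank (hadamard_power A d) = Min {(r + d - 1) choose d, CARD('n), CARD('m)}"
    if A: "A \<in> ?M \<inter> ?T" and d: "d \<ge> 1" for A d
  proof (rule antisym)
    have "rank A = r" using A by (simp add: rank_stratum_def)
    moreover obtain U V where "A = (\<chi> i j. \<Sum>l<rank A. U i l * V j l)"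
      by (rule rank_factorization)
    ultimately have "A = (\<chi> i j. \<Sum>l<r. U i l * V j l)" by (simp only:)
    then have "rank (hadamard_power A d) \<le> (r + d - 1) choose d"
      by (rule rank_hadamard_power_le)
    then show "rank (hadamard_power A d) \<le> Min {(r + d - 1) choose d, CARD('n), CARD('m)}"
      using rank_bound[of "hadamard_power A d"] by simp
    have "?sz d \<le> rank (hadamard_power A d)"
      using A d by (intro hadamard_minor_le_rank[of \<rho> \<kappa>]) (auto simp: hadamard_generic_def)
    then show "Min {(r + d - 1) choose d, CARD('n), CARD('m)} \<le> rank (hadamard_power A d)"
      by (auto simp: k_def min_def split: if_splits)
  qed
  ultimately show ?thesis by blast
qed

end
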